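(* Let $f : (0,\infty) \to \mathbb{R}$ be a continuous function and let $s \in \mathbb{R}$. If $\limsup_{n\to\infty} f(nx) = s$ for all $x \in (0,\infty)$, then $\limsup_{x\to\infty} f(x) = s$. Likewise, if $\limsup_{n\to\infty} f(nx) \le s$ for all $x \in (0,\infty)$, then $\limsup_{x\to\infty} f(x) \le s$.
   Context: Here $n$ ranges over $\mathbb{N}=\{1,2,\ldots\}$. *)

theory Defs
  imports "HOL-Analysis.Analysis"
begin

end

theory Submission
  imports Defs
begin

text \<open>
  The statement is a form of Croft's lemma, and the reason behind it is the Baire category theorem.
  The integers tend to infinity, so the limit superior of \<open>f\<close> at infinity is at least the one
  along the multiples of \<open>x = 1\<close>, and the case of equality reduces to the upper bound. If the upper bound failed, then \<open>f > c\<close> for some \<open>c > s\<close> on an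
  unbounded set \<open>U\<close>, which is open by continuity. A nondegenerate interval of positive numbers
  has dilates by large integers that overlap and so cover a half-line
  (\<open>dilates_cover_half_line\<close>). Hence the points with a late multiple in \<open>U\<close> form a dense open
  set, and the category theorem yields a single point \<open>x\<close> with infinitely many multiples in \<open>U\<close>
  (\<open>multiples_frequently_in_open_unbounded\<close>). Along the multiples of \<open>x\<close> the limit superior is at
  least \<open>c\<close>, contrary to the hypothesis.
\<close>

text \<open>
  The dilate of \<open>(a, b)\<close> by \<open>n\<close> contains \<open>y\<close> exactly when \<open>n\<close> lies in \<open>(y/b, y/a)\<close>, an interval
  whose endpoints and length tend to infinity with \<open>y\<close>.
\<close>
lemma dilates_cover_half_line:
  fixes a b :: real
  assumes "0 < a" "a < b"
  shows "\<forall>\<^sub>F y in at_top. \<exists>n>N. real n * a < y \<and> y < real n * b"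
proof -
  have pos: "0 < 1 / a - 1 / b"
    using assms by (simp add: field_simps)
  have "\<exists>n>N. real n * a < y \<and> y < real n * b"
    if y: "real (Suc N) * b \<le> y" "1 / (1 / a - 1 / b) < y" for y
  proof -
    \<comment> \<open>The least integer exceeding \<open>y/b\<close>.\<close>
    define n where "n = Suc (nat \<lfloor>y / b\<rfloor>)"
    have N: "real (Suc N) \<le> y / b"
      using y(1) assms by (simp add: field_simps)
    have "0 \<le> y / b"
      using N by linarith
    then have n: "y / b < real n" "real n \<le> y / b + 1"
      unfolding n_def by linarith+
    have "1 < y * (1 / a - 1 / b)"
      using y(2) pos by (simp add: pos_divide_less_eq)
    then have "y / b + 1 < y / a"
      by (simp add: algebra_simps)
    with n(2) have "real n < y / a"
      by linarith
    then have "real n * a < y" "y < real n * b"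
      using n(1) assms by (simp_all add: field_simps)
    moreover have "N < n"
      using n(1) N by linarith
    ultimately show ?thesis
      by blast
  qed
  then show ?thesis
    by (rule eventually_elim2[OF eventually_ge_at_top eventually_gt_at_top])
qed

lemma multiples_frequently_in_open_unbounded:
  fixes U :: "real set"
  assumes "open U" and unbounded: "\<exists>\<^sub>F y in at_top. y \<in> U"
  shows "\<exists>x>0. \<exists>\<^sub>F n in sequentially. real n * x \<in> U"
proof -
  \<comment> \<open>The substitution \<open>x = exp t\<close> turns the half-line into the complete space of all reals.\<close>
  define W where "W N = (\<Union>n\<in>{N<..}. (\<lambda>t. real n * exp t) -` U)" for N :: nat
  have "UNIV \<subseteq> closure (\<Inter>(range W))"
  proof (rule Baire)
    fix T assume "T \<in> range W"
    then obtain N where T: "T = W N"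
      by blast
    have "open (W N)"
      unfolding W_def by (intro open_UN ballI open_vimage assms continuous_intros)
    moreover have "t \<in> closure (W N)" for t
    proof (subst closure_approachable, intro allI impI)
      fix e :: real assume "0 < e"
      obtain y n where y: "y \<in> U" and n: "n > N" "real n * exp t < y" "y < real n * exp (t + e)"
        using frequently_ex[OF frequently_eventually_frequently[OF unbounded
            dilates_cover_half_line[of "exp t" "exp (t + e)" N]]] \<open>0 < e\<close>
        by auto
      have "0 < real n" "0 < y"
        using n by (auto intro: le_less_trans[OF _ n(2)])
      define u where "u = ln (y / real n)"
      have u: "real n * exp u = y"
        using \<open>0 < real n\<close> \<open>0 < y\<close> by (simp add: u_def)
      then have "t < u" "u < t + e"
        using n(2,3) \<open>0 < real n\<close> by (auto simp flip: u)
      then have "dist u t < e"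
        by (simp add: dist_real_def)
      moreover have "u \<in> W N"
        using u y n(1) by (auto simp: W_def)
      ultimately show "\<exists>u\<in>W N. dist u t < e"
        by blast
    qed
    ultimately show "openin (top_of_set UNIV) T \<and> UNIV \<subseteq> closure T"
      using T by auto
  qed auto
  then have "\<Inter>(range W) \<noteq> {}"
    by auto
  then obtain t where "\<And>N. t \<in> W N"
    by auto
  then have "\<forall>N. \<exists>n>N. real n * exp t \<in> U"
    by (auto simp: W_def)
  then have "\<exists>\<^sub>F n in sequentially. real n * exp t \<in> U"
    unfolding frequently_sequentially by (meson less_imp_le)
  then show ?thesis
    using exp_gt_zero by blast
qed

lemma Limsup_at_top_le_if_limsup_multiples_le:
  fixes f :: "real \<Rightarrow> real" and s :: ereal
  assumes cont: "continuous_on {0<..} f"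
    and le: "\<And>x. 0 < x \<Longrightarrow> limsup (\<lambda>n. ereal (f (real n * x))) \<le> s"
  shows "Limsup at_top (\<lambda>x. ereal (f x)) \<le> s"
proof (subst Limsup_le_iff, intro allI impI, rule ccontr)
  fix d assume "s < d" and not_ev: "\<not> (\<forall>\<^sub>F x in at_top. ereal (f x) < d)"
  \<comment> \<open>A level strictly below \<open>d\<close> is needed, as only strict superlevel sets are open.\<close>
  obtain c where c: "s < ereal c" "ereal c < d"
    using ereal_dense2[OF \<open>s < d\<close>] by blast
  define U where "U = {0<..} \<inter> f -` {c<..}"
  have "open U"
    unfolding U_def using cont by (intro continuous_open_preimage) auto
  moreover have "\<exists>\<^sub>F y in at_top. y \<in> U"
  proof -
    have "\<exists>\<^sub>F x in at_top. d \<le> ereal (f x)"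
      using not_ev by (simp add: not_eventually not_less)
    then have "\<exists>\<^sub>F x in at_top. d \<le> ereal (f x) \<and> 0 < x"
      by (rule frequently_eventually_frequently) (rule eventually_gt_at_top)
    then show ?thesis
      by (rule frequently_elim1) (use c(2) in \<open>auto simp: U_def dest: less_le_trans\<close>)
  qed
  ultimately obtain x where x: "0 < x" "\<exists>\<^sub>F n in sequentially. real n * x \<in> U"
    using multiples_frequently_in_open_unbounded by blast
  have "\<forall>\<^sub>F n in sequentially. ereal (f (real n * x)) < ereal c"
    using le[OF x(1)] c(1) by (intro Limsup_lessD) (rule le_less_trans)
  then have "\<forall>\<^sub>F n in sequentially. real n * x \<notin> U"
    by (rule eventually_mono) (auto simp: U_def)
  with x(2) show False
    by (simp add: frequently_def)
qed

lemma limsup_of_nat_le_Limsup_at_top: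
  fixes g :: "real \<Rightarrow> 'a :: complete_linorder"
  shows "limsup (\<lambda>n. g (real n)) \<le> Limsup at_top g"
  unfolding Limsup_le_iff
  using filterlim_real_sequentially
  by (auto intro: eventually_compose_filterlim dest: Limsup_lessD)

theorem mainTheorem3:
  fixes f :: "real \<Rightarrow> real" and s :: real
  assumes "continuous_on {0<..} f"
  shows "((\<forall>x\<in>{0<..}. limsup (\<lambda>n. ereal (f (real n * x))) = ereal s) \<longrightarrow>
            Limsup at_top (\<lambda>x. ereal (f x)) = ereal s) \<and>
         ((\<forall>x\<in>{0<..}. limsup (\<lambda>n. ereal (f (real n * x))) \<le> ereal s) \<longrightarrow>
            Limsup at_top (\<lambda>x. ereal (f x)) \<le> ereal s)"
proof (intro conjI impI)
  assume eq: "\<forall>x\<in>{0<..}. limsup (\<lambda>n. ereal (f (real n * x))) = ereal s"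
  show "Limsup at_top (\<lambda>x. ereal (f x)) = ereal s"
  proof (rule antisym)
    show "Limsup at_top (\<lambda>x. ereal (f x)) \<le> ereal s"
      using eq by (intro Limsup_at_top_le_if_limsup_multiples_le[OF assms]) auto
    have "limsup (\<lambda>n. ereal (f (real n))) = ereal s"
      using bspec[OF eq, of 1] by simp
    then show "ereal s \<le> Limsup at_top (\<lambda>x. ereal (f x))"
      using limsup_of_nat_le_Limsup_at_top[of "\<lambda>x. ereal (f x)"] by simp
  qed
next
  assume "\<forall>x\<in>{0<..}. limsup (\<lambda>n. ereal (f (real n * x))) \<le> ereal s"
  then show "Limsup at_top (\<lambda>x. ereal (f x)) \<le> ereal s"
    by (intro Limsup_at_top_le_if_limsup_multiples_le[OF assms]) auto
qed

end
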